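(* Let $A=[\boldsymbol{a}_1,\ldots,\boldsymbol{a}_k]$ be a real $n\times k$ matrix of rank $n$ with columns $\boldsymbol{a}_j$, and let $\mathcal{Z}(A)\subset\mathbb{R}^n$ be the $n$-dimensional zonotope it defines. Then $$\mathrm{vol}_n(\mathcal{Z}(A))=\sum_{1\leq j_1<\cdots<j_n\leq k}\left|\det\left(A^{j_1,\ldots,j_n}\right)\right|,$$ where $A^{j_1,\ldots,j_n}=[\boldsymbol{a}_{j_1},\ldots,\boldsymbol{a}_{j_n}]$.
   Context: $\mathcal{Z}(A)=\{\sum_{i=1}^k t_i\boldsymbol{a}_i\mid 0\leq t_i\leq 1\}$, and $\mathrm{vol}_n$ denotes $n$-dimensional volume (Lebesgue measure). *)

theory Defs
  imports "HOL-Analysis.Analysis"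
begin

text \<open>
  The row index type \<open>'n\<close> plays the role of \<open>{1, \<dots>, n}\<close> and the column index type \<open>'k\<close> that of
  \<open>{1, \<dots>, k}\<close>. Where the order of the indices matters, the types carry a linear order
  (on \<open>'n\<close>, the class \<open>wellorder\<close>, as in the results on Lebesgue measure of linear images in
  \<^theory>\<open>HOL-Analysis.Change_Of_Vars\<close>; a finite linear order is always a well-order).
\<close>

definition zonotope :: "real ^ 'k ^ 'n \<Rightarrow> (real ^ 'n) set" where
  "zonotope A = {\<Sum>i\<in>UNIV. t i *\<^sub>R column i A | t. \<forall>i. 0 \<le> t i \<and> t i \<le> 1}"

text \<open>
  A function \<open>j :: 'n \<Rightarrow> 'k\<close> encodes a tuple \<open>j\<^sub>1, \<dots>, j\<^sub>n\<close> of column indices;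
  \<open>strict_mono j\<close> says \<open>j\<^sub>1 < \<dots> < j\<^sub>n\<close>.
\<close>

definition select_columns :: "real ^ 'k ^ 'n \<Rightarrow> ('n \<Rightarrow> 'k) \<Rightarrow> real ^ 'n ^ 'n" where
  "select_columns A j = (\<chi> r c. column (j c) A $ r)"

end

theory Submission
  imports Defs
begin

text \<open>
  The zonotope is tiled, up to a null set, by translates of the parallelepipeds spanned by the
  bases among the columns of \<open>A\<close>, one translate for each basis; the volume of such a
  parallelepiped is the absolute value of its determinant. The tiling comes from linear programming.

  The zonotope is the image of the unit cube under \<open>t \<mapsto> A t\<close>. Fix a cost vector \<open>c\<close> in general
  position and, for a point \<open>x\<close> of the zonotope, minimise \<open>c \<bullet> t\<close> over the compact set of weight
  vectors \<open>t\<close> in the cube with \<open>A t = x\<close>. Almost every \<open>x\<close> forces the columns with fractional weight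
  to span the space, so these columns contain a basis \<open>j\<close>. Exchanging a column \<open>i\<close> outside the
  basis against the basis is a direction in the kernel of \<open>A\<close>, called \<open>circuit A j i\<close>. Since \<open>c\<close>
  is generic, the sign of \<open>c \<bullet> circuit A j i\<close> (the reduced cost of \<open>i\<close>) is not zero, and minimality
  forces the weight of \<open>i\<close> to be \<open>0\<close> if it is positive and \<open>1\<close> if it is negative. So the weights
  outside the basis depend only on \<open>j\<close>, the weights on the basis fill an open cube, and the
  points \<open>x\<close> that choose the basis \<open>j\<close> lie in the open parallelepiped \<open>tile A c j\<close>
  (\<open>zonotope_minus_tiles_negligible\<close>).

  Conversely, weights of this form are the unique optimum in their fibre
  (\<open>basic_weights_unique_optimum\<close>). A point common to two tiles would therefore have the same
  weights in both, and the position of the fractional weights recovers the basis; hence the tiles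
  are disjoint (\<open>tiles_disjoint\<close>) and their volumes (\<open>tile_measure\<close>) add up to that of the
  zonotope. Column tuples with determinant \<open>0\<close> contribute nothing to the sum.
\<close>

section \<open>Enumerating finite index sets\<close>

lemma strict_mono_enumeration_exists:
  fixes J :: "'k::{finite,linorder} set"
  assumes "card J = CARD('n::{finite,linorder})"
  shows "\<exists>j :: 'n \<Rightarrow> 'k. strict_mono j \<and> range j = J"
proof (intro exI conjI)
  let ?xs = "sorted_list_of_set J"
  define j :: "'n \<Rightarrow> 'k" where "j = (\<lambda>m. ?xs ! card {..<m})"
  have len: "length ?xs = CARD('n)"
    using assms by simp
  \<comment> \<open>\<open>card {..<m}\<close> is the position of \<open>m\<close> in the index type, counted from \<open>0\<close>.\<close>
  have rank_less: "card {..<m} < CARD('n)" for m :: 'n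
    by (rule psubset_card_mono) auto
  show mono: "strict_mono j"
  proof (rule strict_monoI)
    fix m m' :: 'n
    assume "m < m'"
    then have "card {..<m} < card {..<m'}"
      by (intro psubset_card_mono) auto
    then show "j m < j m'"
      unfolding j_def using rank_less[of m'] len strict_sorted_list_of_set[of J]
      by (metis sorted_wrt_nth_less)
  qed
  show "range j = J"
  proof (rule card_subset_eq)
    show "range j \<subseteq> J"
    proof clarify
      fix m :: 'n
      have "?xs ! card {..<m} \<in> set ?xs"
        using rank_less[of m] len by (intro nth_mem) simp
      then show "j m \<in> J"
        by (simp add: j_def)
    qed
    show "card (range j) = card J"
      using assms card_image[OF strict_mono_imp_inj_on[OF mono]] by simp
  qed simp
qed

lemma strict_mono_eq_if_range_eq:
  fixes j j' :: "'n::{finite,linorder} \<Rightarrow> 'k::linorder"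
  assumes "strict_mono j" "strict_mono j'" "range j = range j'"
  shows "j = j'"
proof -
  let ?ms = "sorted_list_of_set (UNIV :: 'n set)"
  have "sorted_wrt (<) (map f ?ms)" if "strict_mono f" for f :: "'n \<Rightarrow> 'k"
    unfolding sorted_wrt_map
    by (rule sorted_wrt_mono_rel[OF _ strict_sorted_list_of_set]) (simp add: strict_monoD[OF that])
  then have "map j ?ms = map j' ?ms"
    using assms by (intro strict_sorted_equal) auto
  then show "j = j'"
    by (simp add: fun_eq_iff)
qed

section \<open>Circuits\<close>

text \<open>
  For an invertible \<open>select_columns A j\<close> this is the kernel vector that puts weight \<open>1\<close> on column
  \<open>i\<close> and compensates on the columns selected by \<open>j\<close>. The number \<open>c \<bullet> circuit A j i\<close> is the reduced
  cost of \<open>i\<close> in the simplex method. The definition does not treat basic indices \<open>i\<close> separately: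
  there the formula gives \<open>0\<close>, so all sums can run over the whole index type.
\<close>

definition circuit :: "real ^ 'k ^ 'n \<Rightarrow> ('n \<Rightarrow> 'k) \<Rightarrow> 'k \<Rightarrow> real ^ 'k" where
  "circuit A j i =
    axis i 1 - (\<Sum>m\<in>UNIV. (matrix_inv (select_columns A j) *v column i A) $ m *\<^sub>R axis (j m) 1)"

lemma column_select_columns: "column m (select_columns A j) = column (j m) A"
  by (simp add: select_columns_def column_def)

lemma matrix_vector_mult_axis_sum:
  fixes A :: "real ^ 'k ^ 'n" and w :: "real ^ 'n"
  shows "A *v (\<Sum>m\<in>UNIV. w $ m *\<^sub>R axis (j m) 1) = select_columns A j *v w"
proof -
  have "A *v (\<Sum>m\<in>UNIV. w $ m *\<^sub>R axis (j m) 1) = (\<Sum>m\<in>UNIV. w $ m *\<^sub>R column (j m) A)"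
    by (simp add: linear_sum[OF matrix_vector_mul_linear] matrix_vector_mult_scaleR
        matrix_vector_mult_basis)
  also have "\<dots> = select_columns A j *v w"
    by (simp add: matrix_mult_sum column_select_columns scalar_mult_eq_scaleR)
  finally show ?thesis .
qed

lemma matrix_inv_mult:
  fixes M :: "real ^ 'n ^ 'n"
  assumes "det M \<noteq> 0"
  shows "M *v (matrix_inv M *v x) = x" "matrix_inv M *v (M *v x) = x"
proof -
  have "\<exists>M'. M ** M' = mat 1 \<and> M' ** M = mat 1"
    using assms invertible_det_nz[of M] by (simp add: invertible_def)
  then have "M ** matrix_inv M = mat 1 \<and> matrix_inv M ** M = mat 1"
    unfolding matrix_inv_def by (rule someI_ex)
  then show "M *v (matrix_inv M *v x) = x" "matrix_inv M *v (M *v x) = x"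
    by (simp_all add: matrix_vector_mul_assoc)
qed

lemma circuit_in_kernel:
  assumes "det (select_columns A j) \<noteq> 0"
  shows "A *v circuit A j i = 0"
  unfolding circuit_def
  by (simp add: matrix_vector_mult_diff_distrib matrix_vector_mult_axis_sum matrix_inv_mult[OF assms]
      matrix_vector_mult_basis)

lemma circuit_nonbasic:
  assumes "l \<notin> range j"
  shows "circuit A j i $ l = (if l = i then 1 else 0)"
proof -
  have "axis (j m) (1::real) $ l = 0" for m
    using assms by (auto simp: axis_def)
  then show ?thesis
    by (simp add: circuit_def axis_def)
qed

lemma circuit_basic:
  assumes "det (select_columns A j) \<noteq> 0"
  shows "circuit A j (j m) = 0"
proof -
  have "matrix_inv (select_columns A j) *v column (j m) A = axis m 1"
    using matrix_inv_mult(2)[OF assms, of "axis m 1"]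
    by (simp add: matrix_vector_mult_basis column_select_columns)
  moreover have "(\<Sum>m'\<in>UNIV. axis m 1 $ m' *\<^sub>R axis (j m') (1::real)) = axis (j m) 1"
    by (subst sum.remove[of _ m]) (auto simp: axis_def intro!: sum.neutral)
  ultimately show ?thesis
    by (simp add: circuit_def)
qed

text \<open>
  The correction terms in the circuits add up to the basis coordinates of \<open>A *v u\<close>, which vanish.
  This identity is what turns cost differences into sums of reduced costs: two weight vectors in
  the same fibre differ by an element of the kernel.
\<close>

lemma kernel_eq_sum_circuits:
  assumes "A *v u = 0"
  shows "u = (\<Sum>i\<in>UNIV. u $ i *\<^sub>R circuit A j i)"
proof -
  let ?N = "matrix_inv (select_columns A j)"
  have "(\<Sum>i\<in>UNIV. u $ i *\<^sub>R (\<Sum>m\<in>UNIV. (?N *v column i A) $ m *\<^sub>R axis (j m) (1::real)))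
      = (\<Sum>m\<in>UNIV. (\<Sum>i\<in>UNIV. u $ i *\<^sub>R (?N *v column i A)) $ m *\<^sub>R axis (j m) 1)"
    unfolding scaleR_sum_right by (subst sum.swap) (simp add: scaleR_sum_left)
  also have "(\<Sum>i\<in>UNIV. u $ i *\<^sub>R (?N *v column i A)) = ?N *v (A *v u)"
    by (simp add: matrix_mult_sum[of A] linear_sum[OF matrix_vector_mul_linear]
        scalar_mult_eq_scaleR matrix_vector_mult_scaleR)
  also have "\<dots> = 0"
    by (simp add: assms)
  finally have "(\<Sum>i\<in>UNIV. u $ i *\<^sub>R circuit A j i) = (\<Sum>i\<in>UNIV. u $ i *\<^sub>R axis i 1)"
    by (simp add: circuit_def scaleR_diff_right sum_subtractf)
  also have "\<dots> = u"
    by (simp add: vec_eq_iff axis_def if_distrib[of "\<lambda>x. _ * x"] cong: if_cong)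
  finally show ?thesis by simp
qed

section \<open>Generic costs\<close>

definition generic_cost :: "real ^ 'k ^ 'n \<Rightarrow> real ^ 'k \<Rightarrow> bool" where
  "generic_cost A c \<longleftrightarrow> (\<forall>j i. i \<notin> range j \<longrightarrow> c \<bullet> circuit A j i \<noteq> 0)"

text \<open>
  Each of the finitely many conditions excludes a hyperplane, because \<open>circuit A j i\<close> has entry
  \<open>1\<close> at a nonbasic \<open>i\<close> and so is not zero.
\<close>

lemma generic_cost_exists:
  fixes A :: "real ^ 'k ^ 'n"
  obtains c where "generic_cost A c"
proof -
  let ?P = "{(j, i). i \<notin> range (j :: 'n \<Rightarrow> 'k)}"
  have "negligible (\<Union>p\<in>?P. {c. circuit A (fst p) (snd p) \<bullet> c = 0})"
  proof (rule negligible_Union, simp, clarsimp)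
    fix j :: "'n \<Rightarrow> 'k" and i
    assume "i \<notin> range j"
    then have "circuit A j i \<noteq> 0"
      using circuit_nonbasic[of i j A i] by auto
    then show "negligible {c. circuit A j i \<bullet> c = 0}"
      by (intro negligible_hyperplane) simp
  qed
  then have "(\<Union>p\<in>?P. {c. circuit A (fst p) (snd p) \<bullet> c = 0}) \<noteq> UNIV"
    by (metis non_negligible_UNIV)
  then obtain c where "\<forall>p\<in>?P. circuit A (fst p) (snd p) \<bullet> c \<noteq> 0"
    by blast
  then have "generic_cost A c"
    by (auto simp: generic_cost_def inner_commute)
  then show ?thesis ..
qed

section \<open>Tiles\<close>

text \<open>
  The candidate optimal solutions with basis \<open>j\<close>. A nonbasic column is used fully exactly when
  raising its weight along its circuit lowers the cost. The strict inequalities on the basis make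
  the basis recoverable from the weights, which gives disjoint tiles.
\<close>

definition basic_weights :: "real ^ 'k ^ 'n \<Rightarrow> real ^ 'k \<Rightarrow> ('n \<Rightarrow> 'k) \<Rightarrow> (real ^ 'k) set" where
  "basic_weights A c j =
    {t. (\<forall>i\<in>range j. 0 < t $ i \<and> t $ i < 1) \<and>
        (\<forall>i. i \<notin> range j \<longrightarrow> t $ i = (if c \<bullet> circuit A j i < 0 then 1 else 0))}"

lemma basic_weights_bounded:
  assumes "t \<in> basic_weights A c j"
  shows "0 \<le> t $ i \<and> t $ i \<le> 1"
  using assms by (cases "i \<in> range j") (auto simp: basic_weights_def intro: less_imp_le)

lemma basic_weights_fractional:
  assumes "t \<in> basic_weights A c j"
  shows "{i. 0 < t $ i \<and> t $ i < 1} = range j"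
proof (intro set_eqI)
  fix i
  show "i \<in> {i. 0 < t $ i \<and> t $ i < 1} \<longleftrightarrow> i \<in> range j"
    using assms by (cases "i \<in> range j") (auto simp: basic_weights_def)
qed

text \<open>
  Sufficiency of the simplex optimality criterion. Written in terms of circuits, the cost
  difference to a competitor \<open>t'\<close> is a sum of terms (change of weight) times (reduced cost); the
  change can only go upwards from \<open>0\<close> where the reduced cost is positive and downwards from \<open>1\<close>
  where it is negative, so every term is nonnegative. If the cost does not increase, all terms
  vanish, and by genericity no nonbasic weight changes; a kernel vector supported on a basis is \<open>0\<close>.
\<close>

lemma basic_weights_unique_optimum:
  assumes gen: "generic_cost A c" and det: "det (select_columns A j) \<noteq> 0"
    and t: "t \<in> basic_weights A c j"
    and t': "\<And>i. 0 \<le> t' $ i \<and> t' $ i \<le> 1" and eq: "A *v t' = A *v t" and le: "c \<bullet> t' \<le> c \<bullet> t"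
  shows "t' = t"
proof -
  define u where "u = t' - t"
  have ker: "A *v u = 0"
    using eq by (simp add: u_def matrix_vector_mult_diff_distrib)
  note u_sum = kernel_eq_sum_circuits[OF ker, of j]
  have nonneg: "0 \<le> u $ i * (c \<bullet> circuit A j i)" for i
  proof (cases "i \<in> range j")
    case True
    then show ?thesis
      by (auto simp: circuit_basic[OF det])
  next
    case False
    then show ?thesis
      using t t'[of i] by (auto simp: basic_weights_def u_def mult_nonpos_nonpos)
  qed
  have "c \<bullet> u = (\<Sum>i\<in>UNIV. u $ i * (c \<bullet> circuit A j i))"
    by (subst u_sum) (simp add: inner_sum_right)
  moreover have "c \<bullet> u \<le> 0"
    using le by (simp add: u_def inner_diff_right)
  ultimately have "\<forall>i\<in>UNIV. u $ i * (c \<bullet> circuit A j i) = 0"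
    using nonneg by (intro iffD1[OF sum_nonneg_eq_0_iff]) (auto intro: antisym sum_nonneg)
  then have "u $ i *\<^sub>R circuit A j i = 0" for i
    using gen by (cases "i \<in> range j") (auto simp: generic_cost_def circuit_basic[OF det])
  then have "(\<Sum>i\<in>UNIV. u $ i *\<^sub>R circuit A j i) = 0"
    by (intro sum.neutral) blast
  with u_sum have "u = 0"
    by (rule trans)
  then show ?thesis
    by (simp add: u_def)
qed

definition tile :: "real ^ 'k ^ 'n \<Rightarrow> real ^ 'k \<Rightarrow> ('n \<Rightarrow> 'k) \<Rightarrow> (real ^ 'n) set" where
  "tile A c j = (*v) A ` basic_weights A c j"

lemma zonotope_eq_image:
  fixes A :: "real ^ 'k ^ 'n"
  shows "zonotope A = (*v) A ` {t. \<forall>i. 0 \<le> t $ i \<and> t $ i \<le> 1}"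
proof (intro equalityI subsetI)
  fix x assume "x \<in> zonotope A"
  then obtain t where t: "\<forall>i. 0 \<le> t i \<and> t i \<le> 1" "x = (\<Sum>i\<in>UNIV. t i *\<^sub>R column i A)"
    by (auto simp: zonotope_def)
  then have "x = A *v (\<chi> i. t i)"
    by (simp add: matrix_mult_sum scalar_mult_eq_scaleR)
  with t(1) show "x \<in> (*v) A ` {t. \<forall>i. 0 \<le> t $ i \<and> t $ i \<le> 1}"
    by (intro image_eqI) auto
next
  fix x assume "x \<in> (*v) A ` {t. \<forall>i. 0 \<le> t $ i \<and> t $ i \<le> 1}"
  then obtain t where "\<forall>i. 0 \<le> t $ i \<and> t $ i \<le> 1" "x = A *v t"
    by blast
  then show "x \<in> zonotope A"
    unfolding zonotope_def mem_Collect_eq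
    by (intro exI[of _ "($) t"]) (simp add: matrix_mult_sum scalar_mult_eq_scaleR)
qed

lemma tile_subset_zonotope: "tile A c j \<subseteq> zonotope A"
proof -
  have "basic_weights A c j \<subseteq> {t. \<forall>i. 0 \<le> t $ i \<and> t $ i \<le> 1}"
    using basic_weights_bounded by blast
  then show ?thesis
    unfolding tile_def zonotope_eq_image by (rule image_mono)
qed

lemma tiles_disjoint:
  fixes A :: "real ^ 'k::{finite,linorder} ^ 'n::{finite,wellorder}"
  assumes gen: "generic_cost A c"
    and "strict_mono j" "det (select_columns A j) \<noteq> 0"
    and "strict_mono j'" "det (select_columns A j') \<noteq> 0"
    and "j \<noteq> j'"
  shows "tile A c j \<inter> tile A c j' = {}"
proof (rule ccontr)
  assume "tile A c j \<inter> tile A c j' \<noteq> {}"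
  then obtain t t' where t: "t \<in> basic_weights A c j" "t' \<in> basic_weights A c j'"
    and eq: "A *v t = A *v t'"
    by (auto simp: tile_def)
  have "t = t'"
  proof (cases "c \<bullet> t' \<le> c \<bullet> t")
    case True
    then show ?thesis
      using basic_weights_unique_optimum[OF gen assms(3) t(1) basic_weights_bounded[OF t(2)] eq[symmetric]]
      by simp
  next
    case False
    then show ?thesis
      using basic_weights_unique_optimum[OF gen assms(5) t(2) basic_weights_bounded[OF t(1)] eq]
      by simp
  qed
  then have "range j = range j'"
    using basic_weights_fractional[OF t(1)] basic_weights_fractional[OF t(2)] by simp
  then show False
    using strict_mono_eq_if_range_eq assms by blast
qed

text \<open>
  With the nonbasic weights fixed, the basic weights range over the open unit cube, so the tile
  is a translate of the image of that cube under \<open>select_columns A j\<close>.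
\<close>

lemma tile_measure:
  fixes A :: "real ^ 'k ^ 'n::{finite,wellorder}"
  assumes "inj j"
  shows "tile A c j \<in> lmeasurable"
    and "measure lebesgue (tile A c j) = \<bar>det (select_columns A j)\<bar>"
proof -
  let ?M = "select_columns A j"
  \<comment> \<open>\<open>t0\<close> holds the nonbasic weights; \<open>emb s\<close> adds the basic weights \<open>s\<close> to them.\<close>
  define t0 :: "real ^ 'k" where
    "t0 = (\<chi> i. if i \<notin> range j \<and> c \<bullet> circuit A j i < 0 then 1 else 0)"
  define emb :: "(real, 'n) vec \<Rightarrow> real ^ 'k" where
    "emb s = t0 + (\<Sum>m\<in>UNIV. s $ m *\<^sub>R axis (j m) 1)" for s
  have emb_basic: "emb s $ j m = s $ m" for s m
  proof -
    have "(\<Sum>m'\<in>UNIV. s $ m' * axis (j m') 1 $ j m) = s $ m"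
      using assms by (subst sum.remove[of _ m]) (auto simp: axis_def inj_eq intro!: sum.neutral)
    then show ?thesis
      by (simp add: emb_def t0_def)
  qed
  have emb_nonbasic: "emb s $ i = t0 $ i" if "i \<notin> range j" for s i
    using that by (auto simp: emb_def axis_def intro!: sum.neutral)
  have "basic_weights A c j = emb ` box 0 1"
  proof (intro equalityI subsetI)
    fix t assume t: "t \<in> basic_weights A c j"
    have "t = emb (\<chi> m. t $ j m)"
    proof (simp only: vec_eq_iff, intro allI)
      fix i
      show "t $ i = emb (\<chi> m. t $ j m) $ i"
        using t by (cases "i \<in> range j") (auto simp: emb_basic emb_nonbasic t0_def basic_weights_def)
    qed
    moreover have "(\<chi> m. t $ j m) \<in> box 0 1"
      using t by (auto simp: mem_box_cart basic_weights_def)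
    ultimately show "t \<in> emb ` box 0 1" by blast
  next
    fix t assume "t \<in> emb ` box 0 1"
    then show "t \<in> basic_weights A c j"
      by (auto simp: basic_weights_def mem_box_cart emb_basic emb_nonbasic t0_def)
  qed
  then have tile: "tile A c j = (+) (A *v t0) ` ((*v) ?M ` box 0 1)"
    by (simp add: tile_def image_image emb_def matrix_vector_right_distrib
        matrix_vector_mult_axis_sum)
  have "measure lebesgue (box 0 (1 :: (real, 'n) vec)) = 1"
  proof -
    have "(1 :: (real, 'n) vec) \<bullet> b = 1" if "b \<in> Basis" for b
      using that by (auto simp: Basis_vec_def inner_axis)
    then show ?thesis
      by (simp add: measure_lborel_box_eq)
  qed
  moreover have "(*v) ?M ` box 0 1 \<in> lmeasurable"
    by (intro measurable_linear_image) auto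
  ultimately show "tile A c j \<in> lmeasurable"
    and "measure lebesgue (tile A c j) = \<bar>det ?M\<bar>"
    by (simp_all add: tile measure_translation measurable_translation measure_linear_image)
qed

section \<open>The tiles cover almost everything\<close>

text \<open>
  Here \<open>dir\<close> says that \<open>u\<close> does not point out of the cube at \<open>t\<close>. A short step along \<open>u\<close> then stays
  in the cube and, as \<open>u\<close> is in the kernel, in the fibre of \<open>t\<close>; it cannot lower the cost.
\<close>

lemma minimiser_feasible_direction:
  fixes t u c :: "real ^ 'k"
  assumes t: "\<And>i. 0 \<le> t $ i \<and> t $ i \<le> 1"
    and min: "\<And>t'. (\<And>i. 0 \<le> t' $ i \<and> t' $ i \<le> 1) \<Longrightarrow> A *v t' = A *v t \<Longrightarrow> c \<bullet> t \<le> c \<bullet> t'"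
    and ker: "A *v u = 0"
    and dir: "\<And>i. u $ i < 0 \<Longrightarrow> 0 < t $ i" "\<And>i. 0 < u $ i \<Longrightarrow> t $ i < 1"
  shows "0 \<le> c \<bullet> u"
proof -
  have "\<forall>\<^sub>F e in at_right 0. 0 \<le> (t + e *\<^sub>R u) $ i \<and> (t + e *\<^sub>R u) $ i \<le> 1" for i
  proof -
    have pos: "\<forall>\<^sub>F e in at_right (0::real). 0 < e"
      by (rule eventually_at_right_less)
    have lim: "((\<lambda>e. t $ i + e * u $ i) \<longlongrightarrow> t $ i) (at_right 0)"
      by (rule tendsto_eq_intros refl | simp)+
    have "\<forall>\<^sub>F e in at_right 0. 0 \<le> t $ i + e * u $ i"
    proof (cases "u $ i < 0")
      case True
      then show ?thesis
        using order_tendstoD(1)[OF lim dir(1)] by (auto elim: eventually_mono)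
    next
      case False
      then show ?thesis
        using pos t[of i] by (auto elim!: eventually_mono)
    qed
    moreover have "\<forall>\<^sub>F e in at_right 0. t $ i + e * u $ i \<le> 1"
    proof (cases "0 < u $ i")
      case True
      then show ?thesis
        using order_tendstoD(2)[OF lim dir(2)] by (auto elim: eventually_mono)
    next
      case False
      then have "t $ i + e * u $ i \<le> 1" if "0 < e" for e
        using t[of i] mult_nonneg_nonpos[of e "u $ i"] that by linarith
      then show ?thesis
        using pos by (auto elim!: eventually_mono)
    qed
    ultimately show ?thesis
      by (simp add: eventually_conj)
  qed
  then have "\<forall>\<^sub>F e in at_right 0. \<forall>i. 0 \<le> (t + e *\<^sub>R u) $ i \<and> (t + e *\<^sub>R u) $ i \<le> 1"
    by (rule eventually_all_finite)
  then have "\<forall>\<^sub>F e in at_right 0. 0 < e \<and> (\<forall>i. 0 \<le> (t + e *\<^sub>R u) $ i \<and> (t + e *\<^sub>R u) $ i \<le> 1)"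
    by (intro eventually_conj eventually_at_right_less)
  then obtain e where "0 < e" and "\<And>i. 0 \<le> (t + e *\<^sub>R u) $ i \<and> (t + e *\<^sub>R u) $ i \<le> 1"
    using eventually_happens'[OF trivial_limit_at_right_real[of 0]] by blast
  then have "c \<bullet> t \<le> c \<bullet> (t + e *\<^sub>R u)"
    by (intro min) (simp_all add: matrix_vector_right_distrib matrix_vector_mult_scaleR ker)
  then show ?thesis
    using \<open>0 < e\<close> by (simp add: inner_add_right zero_le_mult_iff)
qed

text \<open>
  The order on the column indices only serves to select one enumeration of each basis, matching the
  increasing index tuples in the volume formula.
\<close>

lemma spanning_columns_contain_basis:
  fixes A :: "real ^ 'k::{finite,linorder} ^ 'n::{finite,linorder}"
  assumes "span ((\<lambda>i. column i A) ` I) = UNIV"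
  obtains j :: "'n \<Rightarrow> 'k" where "strict_mono j" "range j \<subseteq> I" "det (select_columns A j) \<noteq> 0"
proof -
  let ?col = "\<lambda>i. column i A"
  obtain B where B: "B \<subseteq> ?col ` I" "independent B" "?col ` I \<subseteq> span B"
    by (rule maximal_independent_subset)
  have span_B: "span B = UNIV"
    using B(3) assms by (metis span_minimal subspace_span top.extremum_uniqueI)
  obtain J where J: "J \<subseteq> I" "inj_on ?col J" "B = ?col ` J"
    using B(1) by (auto simp: subset_image_inj)
  have "card J = card B"
    using J by (simp add: card_image)
  also have "\<dots> = dim B"
    using B(2) by (simp add: dim_eq_card_independent)
  also have "\<dots> = CARD('n)"
    using span_B by (metis dim_span dim_UNIV DIM_cart DIM_real mult.right_neutral)
  finally obtain j :: "'n \<Rightarrow> 'k" where j: "strict_mono j" "range j = J"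
    using strict_mono_enumeration_exists by blast
  have "columns (select_columns A j) = B"
    using j(2) by (auto simp: columns_def column_select_columns J(3))
  then have "\<exists>N. select_columns A j ** N = mat 1"
    using span_B by (simp add: matrix_right_invertible_span_columns span_vec_eq)
  then have "det (select_columns A j) \<noteq> 0"
    by (metis invertible_det_nz invertible_right_inverse)
  then show ?thesis
    using that j J(1) by blast
qed

text \<open>
  The weights equal to \<open>1\<close> contribute one of finitely many partial column sums, and the fractional
  ones a vector in the span of their columns. So these points lie in a finite union of translates
  of proper subspaces. Discarding them excludes the degenerate vertices of the linear programs.
\<close>

lemma nonspanning_weights_negligible:
  fixes A :: "real ^ 'k ^ 'n"
  shows "negligible ((*v) A ` {t. (\<forall>i. 0 \<le> t $ i \<and> t $ i \<le> 1) \<and>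
    span ((\<lambda>i. column i A) ` {i. 0 < t $ i \<and> t $ i < 1}) \<noteq> UNIV})" (is "negligible ?E")
proof -
  let ?col = "\<lambda>i. column i A"
  let ?P = "{(K, I). span (?col ` I) \<noteq> UNIV}"
  let ?flat = "\<lambda>(K, I). (+) (sum ?col K) ` span (?col ` I)"
  have "negligible (\<Union> (?flat ` ?P))"
  proof (rule negligible_Union, simp, clarsimp)
    fix K I
    assume "span (?col ` I) \<noteq> UNIV"
    then have "dim (span (?col ` I)) < DIM(real ^ 'n)"
      by (metis dim_eq_full dim_span dim_subset_UNIV le_neq_implies_less)
    then show "negligible ((+) (sum ?col K) ` span (?col ` I))"
      by (intro negligible_translation negligible_lowdim)
  qed
  moreover have "?E \<subseteq> \<Union> (?flat ` ?P)"
  proof clarify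
    fix t :: "real ^ 'k"
    let ?I = "{i. 0 < t $ i \<and> t $ i < 1}" and ?K = "{i. t $ i = 1}"
    assume t: "\<forall>i. 0 \<le> t $ i \<and> t $ i \<le> 1" and ns: "span (?col ` ?I) \<noteq> UNIV"
    have "t $ i *\<^sub>R ?col i =
        (if i \<in> ?K then ?col i else 0) + (if i \<in> ?I then t $ i *\<^sub>R ?col i else 0)" for i
      using t[rule_format, of i] by (auto simp: less_le)
    then have "A *v t = (\<Sum>i\<in>UNIV. (if i \<in> ?K then ?col i else 0) +
        (if i \<in> ?I then t $ i *\<^sub>R ?col i else 0))"
      by (simp add: matrix_mult_sum scalar_mult_eq_scaleR)
    also have "\<dots> = sum ?col ?K + (\<Sum>i\<in>?I. t $ i *\<^sub>R ?col i)"
      by (simp only: sum.distrib sum.If_cases finite Int_UNIV_left Collect_mem_eq sum.neutral_const add_0_right)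
    finally have "A *v t = sum ?col ?K + (\<Sum>i\<in>?I. t $ i *\<^sub>R ?col i)" .
    moreover have "(\<Sum>i\<in>?I. t $ i *\<^sub>R ?col i) \<in> span (?col ` ?I)"
      by (intro span_sum span_scale span_base imageI)
    ultimately have "A *v t \<in> ?flat (?K, ?I)"
      by auto
    with ns show "A *v t \<in> \<Union> (?flat ` ?P)"
      by blast
  qed
  ultimately show ?thesis
    by (rule negligible_subset)
qed

text \<open>
  Necessity of the simplex optimality criterion, for all points outside the null set of
  \<open>nonspanning_weights_negligible\<close>: a cost minimiser whose fractional columns span is a vector of
  basic weights for any basis among these columns.
\<close>

lemma zonotope_minus_tiles_negligible:
  fixes A :: "real ^ 'k::{finite,linorder} ^ 'n::{finite,wellorder}"
  assumes gen: "generic_cost A c"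
  shows "negligible (zonotope A -
    (\<Union>j\<in>{j :: 'n \<Rightarrow> 'k. strict_mono j \<and> det (select_columns A j) \<noteq> 0}. tile A c j))"
proof (rule negligible_subset[OF nonspanning_weights_negligible[of A]], rule subsetI)
  fix x
  assume x: "x \<in> zonotope A -
    (\<Union>j\<in>{j :: 'n \<Rightarrow> 'k. strict_mono j \<and> det (select_columns A j) \<noteq> 0}. tile A c j)"
  let ?F = "cbox 0 1 \<inter> {t. A *v t = x}"
  have mem_F: "t \<in> ?F \<longleftrightarrow> (\<forall>i. 0 \<le> t $ i \<and> t $ i \<le> 1) \<and> A *v t = x" for t
    by (simp add: mem_box_cart)
  have compact: "compact ?F"
    by (intro compact_Int_closed compact_cbox closed_Collect_eq continuous_intros
        linear_continuous_on linear_linear[THEN iffD1] matrix_vector_mul_linear)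
  have "\<exists>t. t \<in> ?F"
    using x by (auto simp only: mem_F zonotope_eq_image image_iff)
  then have "?F \<noteq> {}"
    by blast
  then have "\<exists>t\<in>?F. \<forall>t'\<in>?F. c \<bullet> t \<le> c \<bullet> t'"
    using compact by (intro continuous_attains_inf) (auto intro: continuous_intros)
  then obtain t where "t \<in> ?F" and min: "\<forall>t'\<in>?F. c \<bullet> t \<le> c \<bullet> t'"
    by (rule bexE)
  then have t: "0 \<le> t $ i \<and> t $ i \<le> 1" and At: "A *v t = x" for i
    using mem_F by auto
  have dir: "0 \<le> c \<bullet> u" if "A *v u = 0" "\<And>i. u $ i < 0 \<Longrightarrow> 0 < t $ i" "\<And>i. 0 < u $ i \<Longrightarrow> t $ i < 1" for u
    using minimiser_feasible_direction[OF t _ that] min mem_F At by metis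
  let ?I = "{i. 0 < t $ i \<and> t $ i < 1}"
  have "span ((\<lambda>i. column i A) ` ?I) \<noteq> UNIV"
  proof
    assume "span ((\<lambda>i. column i A) ` ?I) = UNIV"
    then obtain j :: "'n \<Rightarrow> 'k" where j: "strict_mono j" "range j \<subseteq> ?I"
      and det: "det (select_columns A j) \<noteq> 0"
      by (rule spanning_columns_contain_basis)
    have "t $ i = (if c \<bullet> circuit A j i < 0 then 1 else 0)" if i: "i \<notin> range j" for i
    proof -
      let ?u = "circuit A j i"
      have ne: "c \<bullet> ?u \<noteq> 0"
        using gen i by (simp add: generic_cost_def)
      have basic: "0 < t $ l \<and> t $ l < 1" if "?u $ l \<noteq> 0" "l \<noteq> i" for l
        using that j(2) circuit_nonbasic[of l j A i] by auto
      have u_i: "?u $ i = 1"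
        using circuit_nonbasic[OF i] by simp
      \<comment> \<open>The circuit moves only \<open>i\<close> and basic weights, and the latter are strictly between \<open>0\<close> and \<open>1\<close>.
        So it is a feasible direction unless \<open>t $ i = 1\<close>, and its negative is one unless \<open>t $ i = 0\<close>.\<close>
      have up: "0 \<le> c \<bullet> ?u" if "t $ i < 1"
      proof (rule dir)
        show "A *v ?u = 0"
          by (rule circuit_in_kernel[OF det])
        show "0 < t $ l" if "?u $ l < 0" for l
          using that basic[of l] u_i by force
        show "t $ l < 1" if "0 < ?u $ l" for l
          using that basic[of l] \<open>t $ i < 1\<close> by force
      qed
      have down: "0 \<le> c \<bullet> (- ?u)" if "0 < t $ i"
      proof (rule dir)
        show "A *v (- ?u) = 0"
          using circuit_in_kernel[OF det] by (simp add: linear_neg[OF matrix_vector_mul_linear])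
        show "0 < t $ l" if "(- ?u) $ l < 0" for l
          using that basic[of l] \<open>0 < t $ i\<close> by force
        show "t $ l < 1" if "0 < (- ?u) $ l" for l
          using that basic[of l] u_i by force
      qed
      \<comment> \<open>A fractional \<open>t $ i\<close> would make the reduced cost both nonnegative and nonpositive, against \<open>ne\<close>.\<close>
      show ?thesis
        using up down ne t[of i] by force
    qed
    then have "t \<in> basic_weights A c j"
      using j(2) by (auto simp: basic_weights_def)
    then have "x \<in> tile A c j"
      using At by (auto simp: tile_def)
    then show False
      using x j(1) det by blast
  qed
  then show "x \<in> (*v) A ` {t. (\<forall>i. 0 \<le> t $ i \<and> t $ i \<le> 1) \<and>
      span ((\<lambda>i. column i A) ` {i. 0 < t $ i \<and> t $ i < 1}) \<noteq> UNIV}"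
    using t At by blast
qed

section \<open>The volume formula\<close>

theorem proposition3p1:
  fixes A :: "real ^ 'k::{finite,linorder} ^ 'n::{finite,wellorder}"
  assumes "rank A = CARD('n)"
  shows "measure lebesgue (zonotope A) =
    (\<Sum>j | strict_mono (j :: 'n \<Rightarrow> 'k). \<bar>det (select_columns A j)\<bar>)"
proof -
  obtain c where gen: "generic_cost A c"
    by (rule generic_cost_exists)
  let ?J = "{j :: 'n \<Rightarrow> 'k. strict_mono j \<and> det (select_columns A j) \<noteq> 0}"
  let ?U = "\<Union>j\<in>?J. tile A c j"
  have inj: "inj j" if "j \<in> ?J" for j
    using that by (auto intro: strict_mono_imp_inj_on)
  have meas: "tile A c j \<in> lmeasurable" if "j \<in> ?J" for j
    using tile_measure(1) inj[OF that] .
  have "negligible (?U - zonotope A \<union> (zonotope A - ?U))"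
    using zonotope_minus_tiles_negligible[OF gen] tile_subset_zonotope[of A c]
    by (metis (no_types, lifting) Diff_eq_empty_iff UN_least sup_bot_left)
  then have "measure lebesgue (zonotope A) = measure lebesgue ?U"
    using meas by (intro measure_negligible_symdiff fmeasurable.finite_UN) auto
  also have "\<dots> = (\<Sum>j\<in>?J. measure lebesgue (tile A c j))"
    using meas tiles_disjoint[OF gen]
    by (intro measure_UNION') (auto simp: pairwise_def disjnt_def)
  also have "\<dots> = (\<Sum>j\<in>?J. \<bar>det (select_columns A j)\<bar>)"
    using inj by (intro sum.cong refl tile_measure(2))
  also have "\<dots> = (\<Sum>j | strict_mono (j :: 'n \<Rightarrow> 'k). \<bar>det (select_columns A j)\<bar>)"
    by (intro sum.mono_neutral_left) auto
  finally show ?thesis .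
qed

end
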